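(* Let $A$ be an integral domain, $K$ its quotient field and $E$ a nonzero $A$-submodule of $K$ such that $E^2\subseteq E$. Then $A\bowtie E$ is an elementary divisor ring if and only if $A$ is an elementary divisor ring and $A\subseteq E$.
   Context: All rings are commutative with identity. The condition $E^2\subseteq E$ means that $E$ is closed under the multiplication of $K$; then $A+E$ is a subring of $K$ and $E$ is an ideal of $A+E$. The amalgamated duplication of $A$ along $E$ is the subring $A\bowtie E=\{(a,a+e) : a\in A,\ e\in E\}$ of $A\times(A+E)$. A ring $R$ is an elementary divisor ring if for every matrix $M$ over $R$ there exist non-singular (i.e. invertible over $R$) square matrices $P,Q$ over $R$ of appropriate sizes such that $PMQ$ is a diagonal matrix. *)

theory Defs
  imports "HOL-Algebra.Algebra" "Jordan_Normal_Form.Matrix"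
begin

text \<open>The integral domain \<open>A\<close> is taken inside its quotient field \<open>K\<close>, as a subset;
  as a ring it is \<open>K\<lparr>carrier := A\<rparr>\<close>.\<close>

locale quotient_field = field K + subdomain A K for A and K (structure) +
  assumes ex_fraction: "x \<in> carrier K \<Longrightarrow> \<exists>a\<in>A. \<exists>b\<in>A - {\<zero>}. x = a \<otimes> inv b"

text \<open>\<open>K\<close> as a module under its own multiplication; combined with the ring of scalars
  \<open>K\<lparr>carrier := A\<rparr>\<close> it is the \<open>A\<close>-module \<open>K\<close>.\<close>

definition mult_module :: "('a, 'b) ring_scheme \<Rightarrow> ('a, 'a) module"
  where "mult_module K =
    \<lparr>carrier = carrier K, monoid.mult = (\<otimes>\<^bsub>K\<^esub>), one = \<one>\<^bsub>K\<^esub>,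
     ring.zero = \<zero>\<^bsub>K\<^esub>, add = (\<oplus>\<^bsub>K\<^esub>), smult = (\<otimes>\<^bsub>K\<^esub>)\<rparr>"

definition amalgamated_duplication ::
    "('a, 'b) ring_scheme \<Rightarrow> 'a set \<Rightarrow> 'a set \<Rightarrow> ('a \<times> 'a) ring"
  where "amalgamated_duplication K A E =
    (RDirProd (K\<lparr>carrier := A\<rparr>) (K\<lparr>carrier := A <+>\<^bsub>K\<^esub> E\<rparr>))
      \<lparr>carrier := {(a, a \<oplus>\<^bsub>K\<^esub> e) | a e. a \<in> A \<and> e \<in> E}\<rparr>"

text \<open>The matrix operations of \<open>Jordan_Normal_Form\<close> compute in a type class; those below reuse
  the type \<open>'a mat\<close> but compute in a ring given as a record.\<close>

definition mats :: "('a, 'b) ring_scheme \<Rightarrow> nat \<Rightarrow> nat \<Rightarrow> 'a mat set"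
  where "mats R m n = {M \<in> carrier_mat m n. elements_mat M \<subseteq> carrier R}"

definition mats_mult :: "('a, 'b) ring_scheme \<Rightarrow> 'a mat \<Rightarrow> 'a mat \<Rightarrow> 'a mat"
  where "mats_mult R M N = mat (dim_row M) (dim_col N)
    (\<lambda>(i, j). \<Oplus>\<^bsub>R\<^esub>k\<in>{..<dim_col M}. M $$ (i, k) \<otimes>\<^bsub>R\<^esub> N $$ (k, j))"

definition mats_one :: "('a, 'b) ring_scheme \<Rightarrow> nat \<Rightarrow> 'a mat"
  where "mats_one R n = mat n n (\<lambda>(i, j). if i = j then \<one>\<^bsub>R\<^esub> else \<zero>\<^bsub>R\<^esub>)"

definition nonsingular_mats :: "('a, 'b) ring_scheme \<Rightarrow> nat \<Rightarrow> 'a mat set"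
  where "nonsingular_mats R n = {P \<in> mats R n n.
    \<exists>Q \<in> mats R n n. mats_mult R P Q = mats_one R n \<and> mats_mult R Q P = mats_one R n}"

definition diagonal_over :: "('a, 'b) ring_scheme \<Rightarrow> 'a mat \<Rightarrow> bool"
  where "diagonal_over R D \<longleftrightarrow>
    (\<forall>i < dim_row D. \<forall>j < dim_col D. i \<noteq> j \<longrightarrow> D $$ (i, j) = \<zero>\<^bsub>R\<^esub>)"

text \<open>Matrices may be rectangular, and no divisibility condition is imposed on the diagonal
  entries.\<close>

locale elementary_divisor_ring = cring +
  assumes diagonalizable: "M \<in> mats R m n \<Longrightarrow>
    \<exists>P \<in> nonsingular_mats R m. \<exists>Q \<in> nonsingular_mats R n.
      diagonal_over R (mats_mult R (mats_mult R P M) Q)"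

end

theory Submission
  imports Defs
begin

text \<open>If \<open>A \<subseteq> E\<close> then \<open>A + E = E\<close> is an overring of \<open>A\<close> in \<open>K\<close> and \<open>A \<bowtie> E\<close> is the full product
  \<open>A \<times> E\<close>; diagonalization passes from \<open>A\<close> to overrings by clearing denominators, and to products
  componentwise. Conversely \<open>A\<close> is a homomorphic image of \<open>A \<bowtie> E\<close>. Moreover, diagonalizing a
  \<open>1 \<times> 2\<close> matrix shows that two-generated ideals of \<open>A \<bowtie> E\<close> are principal. For a nonzero
  \<open>a \<in> A \<inter> E\<close> let \<open>d\<close> generate the ideal of \<open>(a, 0)\<close> and \<open>(0, a)\<close>. Both components of \<open>d\<close> are nonzero,
  so \<open>(a, 0) = d u\<close> forces \<open>u = (u\<^sub>1, 0)\<close> with \<open>u\<^sub>1 \<in> E\<close>. As the first component of \<open>d\<close> lies in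
  \<open>a A\<close>, this \<open>u\<^sub>1\<close> is a unit of \<open>A\<close>, whence \<open>1 \<in> E\<close>.\<close>

section \<open>Matrices over a ring given as a record\<close>

lemma matsD:
  assumes "M \<in> mats R m n"
  shows "dim_row M = m" "dim_col M = n"
    and "\<And>i j. i < m \<Longrightarrow> j < n \<Longrightarrow> M $$ (i, j) \<in> carrier R"
  using assms unfolding mats_def by auto

lemma matsI:
  assumes "dim_row M = m" "dim_col M = n"
    and "\<And>i j. i < m \<Longrightarrow> j < n \<Longrightarrow> M $$ (i, j) \<in> carrier R"
  shows "M \<in> mats R m n"
  using assms unfolding mats_def by (auto dest!: elements_matD)

lemma dim_mats_mult [simp]:
  "dim_row (mats_mult R M N) = dim_row M" "dim_col (mats_mult R M N) = dim_col N"
  by (simp_all add: mats_mult_def)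

lemma nonsingular_mats_closed: "P \<in> nonsingular_mats R n \<Longrightarrow> P \<in> mats R n n"
  by (simp add: nonsingular_mats_def)

context cring
begin

lemma mats_mult_closed:
  assumes "M \<in> mats R m k" "N \<in> mats R k n"
  shows "mats_mult R M N \<in> mats R m n"
  by (rule matsI) (auto simp: mats_mult_def matsD[OF assms(1)] matsD[OF assms(2)]
      intro!: finsum_closed)

text \<open>By commutativity the scalar moves past the entries of \<open>P\<close> and out of the
  sum. Together with \<open>mats_mult_smult_left\<close> this pulls a denominator \<open>d\<close>,
  multiplied into \<open>M\<close>, out of the whole product \<open>P M Q\<close>.\<close>

lemma mats_mult_smult_right:
  assumes "P \<in> mats R m k" "M \<in> mats R k n" "d \<in> carrier R"
  shows "mats_mult R P (map_mat (\<lambda>x. d \<otimes> x) M) = map_mat (\<lambda>x. d \<otimes> x) (mats_mult R P M)"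
proof (rule eq_matI)
  fix i j
  assume "i < dim_row (map_mat (\<lambda>x. d \<otimes> x) (mats_mult R P M))"
    and "j < dim_col (map_mat (\<lambda>x. d \<otimes> x) (mats_mult R P M))"
  then have ij: "i < m" "j < n"
    by (simp_all add: matsD[OF assms(1)] matsD[OF assms(2)])
  have "(\<Oplus>l\<in>{..<k}. P $$ (i, l) \<otimes> map_mat (\<lambda>x. d \<otimes> x) M $$ (l, j)) =
      (\<Oplus>l\<in>{..<k}. d \<otimes> (P $$ (i, l) \<otimes> M $$ (l, j)))"
    using ij assms(3)
    by (intro finsum_cong') (auto simp: matsD[OF assms(1)] matsD[OF assms(2)] m_lcomm)
  also have "\<dots> = d \<otimes> (\<Oplus>l\<in>{..<k}. P $$ (i, l) \<otimes> M $$ (l, j))"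
    using ij assms(3)
    by (intro finsum_rdistr[symmetric]) (auto simp: matsD[OF assms(1)] matsD[OF assms(2)])
  finally show "mats_mult R P (map_mat (\<lambda>x. d \<otimes> x) M) $$ (i, j) =
      map_mat (\<lambda>x. d \<otimes> x) (mats_mult R P M) $$ (i, j)"
    using ij by (simp add: mats_mult_def matsD[OF assms(1)] matsD[OF assms(2)])
qed (simp_all add: matsD[OF assms(2)])

lemma mats_mult_smult_left:
  assumes "M \<in> mats R m k" "Q \<in> mats R k n" "d \<in> carrier R"
  shows "mats_mult R (map_mat (\<lambda>x. d \<otimes> x) M) Q = map_mat (\<lambda>x. d \<otimes> x) (mats_mult R M Q)"
proof (rule eq_matI)
  fix i j
  assume "i < dim_row (map_mat (\<lambda>x. d \<otimes> x) (mats_mult R M Q))"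
    and "j < dim_col (map_mat (\<lambda>x. d \<otimes> x) (mats_mult R M Q))"
  then have ij: "i < m" "j < n"
    by (simp_all add: matsD[OF assms(1)] matsD[OF assms(2)])
  have "(\<Oplus>l\<in>{..<k}. map_mat (\<lambda>x. d \<otimes> x) M $$ (i, l) \<otimes> Q $$ (l, j)) =
      (\<Oplus>l\<in>{..<k}. d \<otimes> (M $$ (i, l) \<otimes> Q $$ (l, j)))"
    using ij assms(3)
    by (intro finsum_cong') (auto simp: matsD[OF assms(1)] matsD[OF assms(2)] m_assoc)
  also have "\<dots> = d \<otimes> (\<Oplus>l\<in>{..<k}. M $$ (i, l) \<otimes> Q $$ (l, j))"
    using ij assms(3)
    by (intro finsum_rdistr[symmetric]) (auto simp: matsD[OF assms(1)] matsD[OF assms(2)])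
  finally show "mats_mult R (map_mat (\<lambda>x. d \<otimes> x) M) Q $$ (i, j) =
      map_mat (\<lambda>x. d \<otimes> x) (mats_mult R M Q) $$ (i, j)"
    using ij by (simp add: mats_mult_def matsD[OF assms(1)] matsD[OF assms(2)])
qed (simp_all add: matsD[OF assms(1)])

end

section \<open>Matrices under ring homomorphisms, and homomorphic images\<close>

context ring_hom_ring
begin

lemma map_mats:
  "M \<in> mats R m n \<Longrightarrow> map_mat h M \<in> mats S m n"
  by (rule matsI) (auto simp: matsD)

lemma map_mats_mult:
  assumes "M \<in> mats R m k" "N \<in> mats R k n"
  shows "map_mat h (mats_mult R M N) = mats_mult S (map_mat h M) (map_mat h N)"
proof (rule eq_matI)
  fix i j
  assume "i < dim_row (mats_mult S (map_mat h M) (map_mat h N))"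
    and "j < dim_col (mats_mult S (map_mat h M) (map_mat h N))"
  then have ij: "i < m" "j < n"
    by (simp_all add: matsD[OF assms(1)] matsD[OF assms(2)])
  have "h (\<Oplus>\<^bsub>R\<^esub>l\<in>{..<k}. M $$ (i, l) \<otimes>\<^bsub>R\<^esub> N $$ (l, j)) =
      (\<Oplus>\<^bsub>S\<^esub>l\<in>{..<k}. h (M $$ (i, l) \<otimes>\<^bsub>R\<^esub> N $$ (l, j)))"
    using ij by (subst hom_finsum) (auto simp: matsD[OF assms(1)] matsD[OF assms(2)] comp_def)
  also have "\<dots> = (\<Oplus>\<^bsub>S\<^esub>l\<in>{..<k}. map_mat h M $$ (i, l) \<otimes>\<^bsub>S\<^esub> map_mat h N $$ (l, j))"
    using ij by (intro S.finsum_cong') (auto simp: matsD[OF assms(1)] matsD[OF assms(2)])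
  finally show "map_mat h (mats_mult R M N) $$ (i, j) =
      mats_mult S (map_mat h M) (map_mat h N) $$ (i, j)"
    using ij by (simp add: mats_mult_def matsD[OF assms(1)] matsD[OF assms(2)] del: hom_finsum)
qed simp_all

lemma map_mats_one: "map_mat h (mats_one R n) = mats_one S n"
  by (rule eq_matI) (auto simp: mats_one_def)

lemma map_nonsingular_mats:
  assumes "P \<in> nonsingular_mats R n"
  shows "map_mat h P \<in> nonsingular_mats S n"
proof -
  obtain Q where P: "P \<in> mats R n n" and Q: "Q \<in> mats R n n"
    and "mats_mult R P Q = mats_one R n" "mats_mult R Q P = mats_one R n"
    using assms by (auto simp: nonsingular_mats_def)
  then have "mats_mult S (map_mat h P) (map_mat h Q) = mats_one S n"
    and "mats_mult S (map_mat h Q) (map_mat h P) = mats_one S n"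
    using map_mats_mult[OF P Q] map_mats_mult[OF Q P] map_mats_one by simp_all
  then show ?thesis
    using map_mats[OF P] map_mats[OF Q] by (auto simp: nonsingular_mats_def)
qed

lemma map_diagonal_over: "diagonal_over R D \<Longrightarrow> diagonal_over S (map_mat h D)"
  by (simp add: diagonal_over_def)

end

text \<open>A matrix over \<open>S\<close> lifts entrywise to \<open>R\<close> by choosing
  preimages. The matrices that diagonalize the lift are carried by \<open>h\<close> to matrices that
  diagonalize the original, since \<open>h\<close> respects products, inverses and zero.\<close>

lemma (in elementary_divisor_ring) surj_hom_image:
  assumes "cring S" "h \<in> Ring.ring_hom R S" "h ` carrier R = carrier S"
  shows "elementary_divisor_ring S"
proof -
  interpret S: cring S by fact
  interpret hom: ring_hom_ring R S h
    by (intro ring_hom_ringI2 ring_axioms S.ring_axioms assms(2))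
  show ?thesis
  proof
    fix M m n
    assume M: "M \<in> mats S m n"
    define N where "N = map_mat (inv_into (carrier R) h) M"
    have N: "N \<in> mats R m n"
      unfolding N_def using assms(3)
      by (intro matsI) (auto simp: matsD[OF M] intro!: inv_into_into)
    have "map_mat h N = M"
      unfolding N_def using assms(3)
      by (intro eq_matI) (auto simp: matsD[OF M] intro!: f_inv_into_f)
    obtain P Q where P: "P \<in> nonsingular_mats R m" and Q: "Q \<in> nonsingular_mats R n"
      and D: "diagonal_over R (mats_mult R (mats_mult R P N) Q)"
      using diagonalizable[OF N] by blast
    note PQ = nonsingular_mats_closed[OF P] nonsingular_mats_closed[OF Q]
    have "diagonal_over S (mats_mult S (mats_mult S (map_mat h P) M) (map_mat h Q))"
      using hom.map_diagonal_over[OF D] hom.map_mats_mult[OF PQ(1) N]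
        hom.map_mats_mult[OF mats_mult_closed[OF PQ(1) N] PQ(2)] \<open>map_mat h N = M\<close> by simp
    then show "\<exists>P\<in>nonsingular_mats S m. \<exists>Q\<in>nonsingular_mats S n.
        diagonal_over S (mats_mult S (mats_mult S P M) Q)"
      using hom.map_nonsingular_mats P Q by blast
  qed
qed

section \<open>Direct products of rings\<close>

lemma RDirProd_simps:
  "\<one>\<^bsub>RDirProd R S\<^esub> = (\<one>\<^bsub>R\<^esub>, \<one>\<^bsub>S\<^esub>)" "\<zero>\<^bsub>RDirProd R S\<^esub> = (\<zero>\<^bsub>R\<^esub>, \<zero>\<^bsub>S\<^esub>)"
  "(a, b) \<otimes>\<^bsub>RDirProd R S\<^esub> (c, d) = (a \<otimes>\<^bsub>R\<^esub> c, b \<otimes>\<^bsub>S\<^esub> d)"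
  "(a, b) \<oplus>\<^bsub>RDirProd R S\<^esub> (c, d) = (a \<oplus>\<^bsub>R\<^esub> c, b \<oplus>\<^bsub>S\<^esub> d)"
  by (simp_all add: RDirProd_def DirProd_def monoid.defs)

lemma RDirProd_cring:
  assumes "cring R" "cring S"
  shows "cring (RDirProd R S)"
proof -
  interpret R: cring R by fact
  interpret S: cring S by fact
  interpret ring "RDirProd R S"
    by (intro RDirProd_ring R.ring_axioms S.ring_axioms)
  show ?thesis
    by unfold_locales (auto simp: RDirProd_carrier RDirProd_simps R.m_comm S.m_comm)
qed

lemma fst_RDirProd_hom: "fst \<in> Ring.ring_hom (RDirProd R S) R"
  by (auto simp: Ring.ring_hom_def RDirProd_carrier RDirProd_simps)

lemma snd_RDirProd_hom: "snd \<in> Ring.ring_hom (RDirProd R S) S"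
  by (auto simp: Ring.ring_hom_def RDirProd_carrier RDirProd_simps)

text \<open>The dimensions come from \<open>M\<close> alone, which is why
  \<open>snd_pair_mat\<close> asks for matching dimensions and \<open>fst_pair_mat\<close> does
  not.\<close>

definition pair_mat :: "'a mat \<Rightarrow> 'b mat \<Rightarrow> ('a \<times> 'b) mat"
  where "pair_mat M N = mat (dim_row M) (dim_col M) (\<lambda>ij. (M $$ ij, N $$ ij))"

lemma fst_pair_mat: "map_mat fst (pair_mat M N) = M"
  by (rule eq_matI) (auto simp: pair_mat_def)

lemma snd_pair_mat:
  "dim_row M = dim_row N \<Longrightarrow> dim_col M = dim_col N \<Longrightarrow> map_mat snd (pair_mat M N) = N"
  by (rule eq_matI) (auto simp: pair_mat_def)

lemma mat_prod_eqI:
  assumes "map_mat fst M = map_mat fst N" "map_mat snd M = map_mat snd N"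
  shows "M = N"
proof (rule eq_matI)
  show dim: "dim_row M = dim_row N" "dim_col M = dim_col N"
    using arg_cong[OF assms(1), of dim_row] arg_cong[OF assms(1), of dim_col] by simp_all
  fix i j
  assume "i < dim_row N" "j < dim_col N"
  then show "M $$ (i, j) = N $$ (i, j)"
    using arg_cong[OF assms(1), of "\<lambda>M. M $$ (i, j)"] arg_cong[OF assms(2), of "\<lambda>M. M $$ (i, j)"] dim
    by (simp add: prod_eq_iff)
qed

lemma pair_mats:
  assumes "M \<in> mats R m n" "N \<in> mats S m n"
  shows "pair_mat M N \<in> mats (RDirProd R S) m n"
  by (rule matsI) (auto simp: pair_mat_def RDirProd_carrier matsD[OF assms(1)] matsD[OF assms(2)])

lemma pair_nonsingular_mats:
  assumes "ring R" "ring S" "P \<in> nonsingular_mats R n" "P' \<in> nonsingular_mats S n"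
  shows "pair_mat P P' \<in> nonsingular_mats (RDirProd R S) n"
proof -
  let ?T = "RDirProd R S"
  interpret f: ring_hom_ring ?T R fst
    by (intro ring_hom_ringI2 RDirProd_ring fst_RDirProd_hom assms)
  interpret s: ring_hom_ring ?T S snd
    by (intro ring_hom_ringI2 RDirProd_ring snd_RDirProd_hom assms)
  \<comment> \<open>An equation between matrices over the product is checked after each projection.
    Both projections are ring homomorphisms, so they turn the product of pairs into the given
    products over \<open>R\<close> and \<open>S\<close>.\<close>
  have inverse: "mats_mult ?T (pair_mat A A') (pair_mat B B') = mats_one ?T n"
    if "A \<in> mats R n n" "B \<in> mats R n n" "A' \<in> mats S n n" "B' \<in> mats S n n"
      "mats_mult R A B = mats_one R n" "mats_mult S A' B' = mats_one S n" for A B A' B'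
    using that f.map_mats_mult[OF pair_mats pair_mats, of A n n A' B n B']
      s.map_mats_mult[OF pair_mats pair_mats, of A n n A' B n B']
    by (intro mat_prod_eqI)
      (simp_all add: f.map_mats_one s.map_mats_one fst_pair_mat snd_pair_mat matsD)
  obtain Q Q' where "Q \<in> mats R n n" "mats_mult R P Q = mats_one R n" "mats_mult R Q P = mats_one R n"
    and "Q' \<in> mats S n n" "mats_mult S P' Q' = mats_one S n" "mats_mult S Q' P' = mats_one S n"
    and "P \<in> mats R n n" "P' \<in> mats S n n"
    using assms(3,4) by (auto simp: nonsingular_mats_def)
  then show ?thesis
    unfolding nonsingular_mats_def by (auto intro!: pair_mats bexI[of _ "pair_mat Q Q'"] inverse)
qed

text \<open>The two projections of \<open>M\<close> are diagonalized independently and the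
  transforming matrices are paired. An off-diagonal entry then vanishes in both components, which is
  what zero means in the product.\<close>

lemma elementary_divisor_ring_RDirProd:
  assumes "elementary_divisor_ring R" "elementary_divisor_ring S"
  shows "elementary_divisor_ring (RDirProd R S)"
proof -
  let ?T = "RDirProd R S"
  interpret R: elementary_divisor_ring R by fact
  interpret S: elementary_divisor_ring S by fact
  interpret T: cring ?T
    by (intro RDirProd_cring R.cring_axioms S.cring_axioms)
  interpret f: ring_hom_ring ?T R fst
    by (intro ring_hom_ringI2 T.ring_axioms R.ring_axioms fst_RDirProd_hom)
  interpret s: ring_hom_ring ?T S snd
    by (intro ring_hom_ringI2 T.ring_axioms S.ring_axioms snd_RDirProd_hom)
  show ?thesis
  proof
    fix M m n
    assume M: "M \<in> mats ?T m n"
    obtain P Q where P: "P \<in> nonsingular_mats R m" and Q: "Q \<in> nonsingular_mats R n"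
      and D: "diagonal_over R (mats_mult R (mats_mult R P (map_mat fst M)) Q)"
      using R.diagonalizable[OF f.map_mats[OF M]] by blast
    obtain P' Q' where P': "P' \<in> nonsingular_mats S m" and Q': "Q' \<in> nonsingular_mats S n"
      and D': "diagonal_over S (mats_mult S (mats_mult S P' (map_mat snd M)) Q')"
      using S.diagonalizable[OF s.map_mats[OF M]] by blast
    note mats = nonsingular_mats_closed[OF P] nonsingular_mats_closed[OF Q]
      nonsingular_mats_closed[OF P'] nonsingular_mats_closed[OF Q']
    let ?P = "pair_mat P P'" and ?Q = "pair_mat Q Q'"
    let ?D = "mats_mult ?T (mats_mult ?T ?P M) ?Q"
    have PP: "?P \<in> mats ?T m m" and QQ: "?Q \<in> mats ?T n n"
      using mats by (auto intro: pair_mats)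
    have "map_mat fst ?D = mats_mult R (mats_mult R P (map_mat fst M)) Q"
      by (simp add: f.map_mats_mult[OF T.mats_mult_closed[OF PP M] QQ] f.map_mats_mult[OF PP M]
          fst_pair_mat)
    moreover have "map_mat snd ?D = mats_mult S (mats_mult S P' (map_mat snd M)) Q'"
      using mats
      by (simp add: s.map_mats_mult[OF T.mats_mult_closed[OF PP M] QQ] s.map_mats_mult[OF PP M]
          snd_pair_mat matsD)
    ultimately have "diagonal_over R (map_mat fst ?D)" "diagonal_over S (map_mat snd ?D)"
      using D D' by simp_all
    then have "diagonal_over ?T ?D"
      by (simp add: diagonal_over_def RDirProd_simps prod_eq_iff)
    then show "\<exists>P\<in>nonsingular_mats ?T m. \<exists>Q\<in>nonsingular_mats ?T n.
        diagonal_over ?T (mats_mult ?T (mats_mult ?T P M) Q)"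
      using pair_nonsingular_mats[OF R.ring_axioms S.ring_axioms P P']
        pair_nonsingular_mats[OF R.ring_axioms S.ring_axioms Q Q'] by blast
  qed
qed

section \<open>Two-generated ideals from the diagonalization of a row\<close>

lemma (in elementary_divisor_ring) two_generated_ideal_principal:
  assumes "x \<in> carrier R" "y \<in> carrier R"
  obtains d u v p q where "d \<in> carrier R" "u \<in> carrier R" "v \<in> carrier R" "p \<in> carrier R" "q \<in> carrier R"
    and "x = d \<otimes> u" "y = d \<otimes> v" "d = x \<otimes> p \<oplus> y \<otimes> q"
proof -
  define M where "M = mat 1 2 (\<lambda>(i, j). if j = 0 then x else y)"
  have M: "M \<in> mats R 1 2"
    by (rule matsI) (use assms in \<open>auto simp: M_def\<close>)
  obtain P Q where P: "P \<in> nonsingular_mats R 1" and Q: "Q \<in> nonsingular_mats R 2"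
    and D: "diagonal_over R (mats_mult R (mats_mult R P M) Q)"
    using diagonalizable[OF M] by blast
  obtain P' where P': "P' \<in> mats R 1 1" "mats_mult R P' P = mats_one R 1"
    using P by (auto simp: nonsingular_mats_def)
  obtain Q' where Q': "Q' \<in> mats R 2 2" "mats_mult R Q Q' = mats_one R 2"
    using Q by (auto simp: nonsingular_mats_def)
  note PQ = nonsingular_mats_closed[OF P] nonsingular_mats_closed[OF Q]
  note dims = matsD(1,2)[OF PQ(1)] matsD(1,2)[OF PQ(2)] matsD(1,2)[OF P'(1)] matsD(1,2)[OF Q'(1)]
  \<comment> \<open>\<open>P\<close> amounts to a unit \<open>s\<close> with inverse
    \<open>s'\<close>; the \<open>q\<close> and \<open>r\<close> are the entries of \<open>Q\<close>
    and of its inverse \<open>Q'\<close>.\<close>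
  define s s' where "s = P $$ (0, 0)" and "s' = P' $$ (0, 0)"
  define q00 q01 q10 q11 where "q00 = Q $$ (0, 0)" and "q01 = Q $$ (0, Suc 0)"
    and "q10 = Q $$ (Suc 0, 0)" and "q11 = Q $$ (Suc 0, Suc 0)"
  define r00 r01 r10 r11 where "r00 = Q' $$ (0, 0)" and "r01 = Q' $$ (0, Suc 0)"
    and "r10 = Q' $$ (Suc 0, 0)" and "r11 = Q' $$ (Suc 0, Suc 0)"
  note defs = s_def s'_def q00_def q01_def q10_def q11_def r00_def r01_def r10_def r11_def
  have closed: "s \<in> carrier R" "s' \<in> carrier R"
    "q00 \<in> carrier R" "q01 \<in> carrier R" "q10 \<in> carrier R" "q11 \<in> carrier R"
    "r00 \<in> carrier R" "r01 \<in> carrier R" "r10 \<in> carrier R" "r11 \<in> carrier R"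
    unfolding defs using matsD(3)[OF PQ(1)] matsD(3)[OF PQ(2)] matsD(3)[OF P'(1)] matsD(3)[OF Q'(1)]
    by auto
  have two: "{..<2} = {0, Suc 0}" and one: "{..<Suc 0} = {0}"
    by auto
  have "mats_mult R P' P $$ (0, 0) = \<one>"
    using P'(2) by (simp add: mats_one_def)
  then have s's: "s' \<otimes> s = \<one>"
    using closed by (simp add: mats_mult_def dims one flip: s_def s'_def)
  have QQ': "q00 \<otimes> r00 \<oplus> q01 \<otimes> r10 = \<one>" "q00 \<otimes> r01 \<oplus> q01 \<otimes> r11 = \<zero>"
    "q10 \<otimes> r00 \<oplus> q11 \<otimes> r10 = \<zero>" "q10 \<otimes> r01 \<oplus> q11 \<otimes> r11 = \<one>"
    using arg_cong[OF Q'(2), of "\<lambda>M. M $$ (0, 0)"] arg_cong[OF Q'(2), of "\<lambda>M. M $$ (0, 1)"]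
      arg_cong[OF Q'(2), of "\<lambda>M. M $$ (1, 0)"] arg_cong[OF Q'(2), of "\<lambda>M. M $$ (1, 1)"] closed
    by (simp_all add: mats_mult_def mats_one_def dims two flip: defs)
  \<comment> \<open>The position \<open>(0, 1)\<close> is the only off-diagonal one in a row of
    length two. Cancelling the unit \<open>s\<close> from this entry leaves the second entry of
    \<open>M Q\<close> equal to zero.\<close>
  have "mats_mult R (mats_mult R P M) Q $$ (0, 1) = \<zero>"
    using D by (simp add: diagonal_over_def dims matsD[OF M])
  then have "s \<otimes> x \<otimes> q01 \<oplus> s \<otimes> y \<otimes> q11 = \<zero>"
    using closed assms by (simp add: mats_mult_def M_def dims one two flip: defs)
  then have "s' \<otimes> (s \<otimes> x \<otimes> q01 \<oplus> s \<otimes> y \<otimes> q11) = \<zero>"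
    using closed by simp
  moreover have "s' \<otimes> (s \<otimes> x \<otimes> q01 \<oplus> s \<otimes> y \<otimes> q11) = s' \<otimes> s \<otimes> (x \<otimes> q01 \<oplus> y \<otimes> q11)"
    using closed assms by algebra
  ultimately have kill: "x \<otimes> q01 \<oplus> y \<otimes> q11 = \<zero>"
    using s's closed assms by simp
  \<comment> \<open>Now \<open>M Q\<close> is the row \<open>(d, 0)\<close>, so
    \<open>M = (d, 0) Q'\<close>, and \<open>x\<close> and \<open>y\<close> are the multiples of
    \<open>d\<close> by the first row of \<open>Q'\<close>. The two identities below expand the
    entries of \<open>(M Q) Q' = M (Q Q')\<close>.\<close>
  define d where "d = x \<otimes> q00 \<oplus> y \<otimes> q10"
  have "d \<otimes> r00 \<oplus> (x \<otimes> q01 \<oplus> y \<otimes> q11) \<otimes> r10 =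
      x \<otimes> (q00 \<otimes> r00 \<oplus> q01 \<otimes> r10) \<oplus> y \<otimes> (q10 \<otimes> r00 \<oplus> q11 \<otimes> r10)"
    unfolding d_def using closed assms by algebra
  then have x: "x = d \<otimes> r00"
    using kill QQ' closed assms by (simp add: d_def)
  have "d \<otimes> r01 \<oplus> (x \<otimes> q01 \<oplus> y \<otimes> q11) \<otimes> r11 =
      x \<otimes> (q00 \<otimes> r01 \<oplus> q01 \<otimes> r11) \<oplus> y \<otimes> (q10 \<otimes> r01 \<oplus> q11 \<otimes> r11)"
    unfolding d_def using closed assms by algebra
  then have y: "y = d \<otimes> r01"
    using kill QQ' closed assms by (simp add: d_def)
  have "d \<in> carrier R"
    using closed assms by (simp add: d_def)
  then show thesis
    using closed(7,8,3,5) x y d_def by (rule that)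
qed

section \<open>Elements and operations of the duplication\<close>

lemma amalgamated_duplication_carrier:
  "carrier (amalgamated_duplication K A E) = {(a, a \<oplus>\<^bsub>K\<^esub> e) | a e. a \<in> A \<and> e \<in> E}"
  by (simp add: amalgamated_duplication_def)

lemma amalgamated_duplication_simps:
  "\<one>\<^bsub>amalgamated_duplication K A E\<^esub> = (\<one>\<^bsub>K\<^esub>, \<one>\<^bsub>K\<^esub>)"
  "\<zero>\<^bsub>amalgamated_duplication K A E\<^esub> = (\<zero>\<^bsub>K\<^esub>, \<zero>\<^bsub>K\<^esub>)"
  "(a, b) \<otimes>\<^bsub>amalgamated_duplication K A E\<^esub> (c, d) = (a \<otimes>\<^bsub>K\<^esub> c, b \<otimes>\<^bsub>K\<^esub> d)"
  "(a, b) \<oplus>\<^bsub>amalgamated_duplication K A E\<^esub> (c, d) = (a \<oplus>\<^bsub>K\<^esub> c, b \<oplus>\<^bsub>K\<^esub> d)"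
  by (simp_all add: amalgamated_duplication_def RDirProd_simps)

section \<open>Common denominators and overrings inside the quotient field\<close>

context quotient_field
begin

text \<open>Induction on the finite set: the denominator \<open>d\<close> found so far is multiplied
  by a denominator \<open>b\<close> of the new element. The product stays nonzero because there are
  no zero divisors.\<close>

lemma ex_common_denominator:
  assumes "finite F" "F \<subseteq> carrier K"
  shows "\<exists>d\<in>A - {\<zero>}. \<forall>x\<in>F. d \<otimes> x \<in> A"
  using assms
proof (induction F)
  case empty
  then show ?case using one_closed sub_one_not_zero by blast
next
  case (insert x F)
  note A = subdomainE(1-7)[OF subdomain_axioms]
  obtain d where d: "d \<in> A" "d \<noteq> \<zero>" "\<And>z. z \<in> F \<Longrightarrow> d \<otimes> z \<in> A"
    using insert by auto
  obtain a b where ab: "a \<in> A" "b \<in> A" "b \<noteq> \<zero>" "x = a \<otimes> inv b"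
    using ex_fraction[of x] insert.prems by auto
  have K: "a \<in> carrier K" "b \<in> carrier K" "d \<in> carrier K" "inv b \<in> carrier K" "b \<otimes> inv b = \<one>"
    using ab d A(1) field_Units by (auto intro!: Units_inv_closed Units_r_inv)
  have "d \<otimes> b \<otimes> (a \<otimes> inv b) = d \<otimes> a \<otimes> (b \<otimes> inv b)"
    using K(1-4) by algebra
  then have "d \<otimes> b \<otimes> x \<in> A"
    using ab d K A by simp
  moreover have "d \<otimes> b \<otimes> z \<in> A" if "z \<in> F" for z
  proof -
    have "d \<otimes> b \<otimes> z = b \<otimes> (d \<otimes> z)"
      using that insert.prems K by (auto simp: m_ac)
    then show ?thesis using that ab d A by simp
  qed
  moreover have "d \<otimes> b \<in> A - {\<zero>}"
    using ab d K A integral[of d b] by auto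
  ultimately show ?case by auto
qed

text \<open>For a common denominator \<open>d\<close> of the entries of \<open>M\<close>, the matrix
  \<open>d M\<close> lies over \<open>A\<close>. Matrices \<open>P\<close> and \<open>Q\<close>
  diagonalizing it over \<open>A\<close> remain invertible over \<open>B\<close>, and
  \<open>P (d M) Q = d (P M Q)\<close>. Off-diagonal zeros survive cancelling the nonzero
  \<open>d\<close> in \<open>K\<close>.\<close>

lemma elementary_divisor_overring:
  assumes "elementary_divisor_ring (K\<lparr>carrier := A\<rparr>)" "subring B K" "A \<subseteq> B"
  shows "elementary_divisor_ring (K\<lparr>carrier := B\<rparr>)"
proof -
  let ?A = "K\<lparr>carrier := A\<rparr>" and ?B = "K\<lparr>carrier := B\<rparr>"
  note BK = subringE(1)[OF assms(2)]
  interpret A: elementary_divisor_ring ?A by fact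
  interpret B: domain ?B by (rule subring_is_domain[OF assms(2)])
  interpret incl: ring_hom_ring ?A ?B id
    by (intro ring_hom_ringI2 A.ring_axioms B.ring_axioms ring_hom_memI)
      (simp_all add: subsetD[OF assms(3)])
  have map_id: "map_mat id M = M" for M :: "'a mat"
    by auto
  show ?thesis
  proof
    fix M m n
    assume M: "M \<in> mats ?B m n"
    have "finite (elements_mat M)" "elements_mat M \<subseteq> carrier K"
      using M BK by (auto simp: elements_mat_def mats_def)
    then obtain d where d: "d \<in> A" "d \<noteq> \<zero>" and dM: "\<And>x. x \<in> elements_mat M \<Longrightarrow> d \<otimes> x \<in> A"
      using ex_common_denominator[of "elements_mat M"] by auto
    let ?N = "map_mat (\<lambda>x. d \<otimes> x) M"
    have N: "?N \<in> mats ?A m n"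
      using M dM by (auto simp: mats_def)
    obtain P Q where P: "P \<in> nonsingular_mats ?A m" and Q: "Q \<in> nonsingular_mats ?A n"
      and D: "diagonal_over ?A (mats_mult ?A (mats_mult ?A P ?N) Q)"
      using A.diagonalizable[OF N] by blast
    note PQ = nonsingular_mats_closed[OF P] nonsingular_mats_closed[OF Q]
    have PB: "P \<in> nonsingular_mats ?B m" and QB: "Q \<in> nonsingular_mats ?B n"
      using incl.map_nonsingular_mats[OF P] incl.map_nonsingular_mats[OF Q] by (simp_all add: map_id)
    note PQB = nonsingular_mats_closed[OF PB] nonsingular_mats_closed[OF QB]
    let ?D = "mats_mult ?B (mats_mult ?B P M) Q"
    have DB: "?D \<in> mats ?B m n"
      by (rule B.mats_mult_closed[OF B.mats_mult_closed[OF PQB(1) M] PQB(2)])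
    \<comment> \<open>Mapping by the inclusion \<open>id\<close> leaves a matrix unchanged but moves
      the computation of \<open>mats_mult\<close> from \<open>A\<close> to \<open>B\<close>.\<close>
    have "mats_mult ?A (mats_mult ?A P ?N) Q = mats_mult ?B (mats_mult ?B P ?N) Q"
      using incl.map_mats_mult[OF PQ(1) N] incl.map_mats_mult[OF A.mats_mult_closed[OF PQ(1) N] PQ(2)]
      by (simp add: map_id)
    also have "\<dots> = map_mat (\<lambda>x. d \<otimes> x) ?D"
      using B.mats_mult_smult_right[OF PQB(1) M, of d]
        B.mats_mult_smult_left[OF B.mats_mult_closed[OF PQB(1) M] PQB(2), of d] subsetD[OF assms(3) d(1)]
      by simp
    finally have "diagonal_over ?A (map_mat (\<lambda>x. d \<otimes> x) ?D)"
      using D by simp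
    then have "d \<otimes> ?D $$ (i, j) = \<zero>" if "i < m" "j < n" "i \<noteq> j" for i j
      using that matsD(1,2)[OF DB] by (simp add: diagonal_over_def del: dim_mats_mult)
    moreover have "?D $$ (i, j) \<in> carrier K" if "i < m" "j < n" for i j
      using matsD(3)[OF DB that] BK by auto
    moreover have "d \<in> carrier K"
      using d(1) assms(3) BK by blast
    ultimately have "?D $$ (i, j) = \<zero>" if "i < m" "j < n" "i \<noteq> j" for i j
      using that d(2) integral by blast
    then have "diagonal_over ?B ?D"
      using matsD(1,2)[OF DB] by (simp add: diagonal_over_def del: dim_mats_mult)
    then show "\<exists>P\<in>nonsingular_mats ?B m. \<exists>Q\<in>nonsingular_mats ?B n.
        diagonal_over ?B (mats_mult ?B (mats_mult ?B P M) Q)"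
      using PB QB by blast
  qed
qed

end

section \<open>The equivalence for the duplication along \<open>E\<close>\<close>

theorem corollary2p6:
  fixes K :: "('a, 'b) ring_scheme" and A E :: "'a set"
  assumes "quotient_field A K"
    and "submodule E (K\<lparr>carrier := A\<rparr>) (mult_module K)"
    and "E \<noteq> {\<zero>\<^bsub>K\<^esub>}"
    and "E <#>\<^bsub>K\<^esub> E \<subseteq> E"
  shows "elementary_divisor_ring (amalgamated_duplication K A E) \<longleftrightarrow>
    elementary_divisor_ring (K\<lparr>carrier := A\<rparr>) \<and> A \<subseteq> E"
proof -
  interpret quotient_field A K by fact
  interpret E: submodule E "K\<lparr>carrier := A\<rparr>" "mult_module K" by fact
  note A = subdomainE(1-7)[OF subdomain_axioms]
  let ?R = "amalgamated_duplication K A E"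
  \<comment> \<open>A \<open>submodule\<close> is a subgroup of the additive monoid, so
    \<open>E.one_closed\<close> and \<open>E.m_closed\<close> speak of zero and of addition.\<close>
  have EK: "E \<subseteq> carrier K" and E0: "\<zero>\<^bsub>K\<^esub> \<in> E"
    and Eadd: "\<And>x y. x \<in> E \<Longrightarrow> y \<in> E \<Longrightarrow> x \<oplus>\<^bsub>K\<^esub> y \<in> E"
    and Esmult: "\<And>a x. a \<in> A \<Longrightarrow> x \<in> E \<Longrightarrow> a \<otimes>\<^bsub>K\<^esub> x \<in> E"
    using E.subset E.one_closed E.m_closed E.smult_closed by (auto simp: mult_module_def)
  have Emult: "x \<otimes>\<^bsub>K\<^esub> y \<in> E" if "x \<in> E" "y \<in> E" for x y
    using that assms(4) by (auto simp: set_mult_def)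
  have Eneg: "\<ominus>\<^bsub>K\<^esub> x \<in> E" if "x \<in> E" for x
  proof -
    \<comment> \<open>Negation in \<open>K\<close> is multiplication by the scalar -1, which lies in
      \<open>A\<close>.\<close>
    have "\<ominus>\<^bsub>K\<^esub> \<one>\<^bsub>K\<^esub> \<otimes>\<^bsub>K\<^esub> x = \<ominus>\<^bsub>K\<^esub> x"
      using that EK by (simp add: l_minus subsetD)
    then show ?thesis
      using Esmult[OF subringE(5)[OF subring_axioms subringE(3)[OF subring_axioms]] that] by metis
  qed
  have Ediff: "y \<ominus>\<^bsub>K\<^esub> x \<in> E" if "x \<in> E" "y \<in> E" for x y
    using that Eadd Eneg by (simp add: minus_eq)
  \<comment> \<open>The element \<open>e\<close> in a pair \<open>(x, x + e)\<close> can only be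
    \<open>y - x\<close>, so membership becomes a condition free of existentials.\<close>
  have mem: "(x, y) \<in> carrier ?R \<longleftrightarrow> x \<in> A \<and> y \<in> carrier K \<and> y \<ominus>\<^bsub>K\<^esub> x \<in> E" for x y
  proof
    assume "(x, y) \<in> carrier ?R"
    then obtain e where e: "x \<in> A" "e \<in> E" "y = x \<oplus>\<^bsub>K\<^esub> e"
      by (auto simp: amalgamated_duplication_carrier)
    then have "x \<in> carrier K" "e \<in> carrier K"
      using A(1) EK by auto
    moreover from this have "y \<ominus>\<^bsub>K\<^esub> x = e"
      unfolding e(3) by algebra
    ultimately show "x \<in> A \<and> y \<in> carrier K \<and> y \<ominus>\<^bsub>K\<^esub> x \<in> E"
      using e by simp
  next
    assume xy: "x \<in> A \<and> y \<in> carrier K \<and> y \<ominus>\<^bsub>K\<^esub> x \<in> E"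
    then have "x \<in> carrier K" "y \<in> carrier K"
      using A(1) by auto
    then have "y = x \<oplus>\<^bsub>K\<^esub> (y \<ominus>\<^bsub>K\<^esub> x)"
      by algebra
    then show "(x, y) \<in> carrier ?R"
      using xy by (auto simp: amalgamated_duplication_carrier)
  qed
  show ?thesis
  proof
    assume "elementary_divisor_ring ?R"
    then interpret R: elementary_divisor_ring ?R .
    have "fst \<in> Ring.ring_hom ?R (K\<lparr>carrier := A\<rparr>)"
      by (auto simp: Ring.ring_hom_def amalgamated_duplication_carrier amalgamated_duplication_simps)
    \<comment> \<open>Surjectivity: zero in \<open>E\<close> puts every \<open>(a, a)\<close> into
      the duplication.\<close>
    moreover have "fst ` carrier ?R = A"
      using E0 by (force simp: amalgamated_duplication_carrier)
    ultimately have "elementary_divisor_ring (K\<lparr>carrier := A\<rparr>)"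
      using R.surj_hom_image[of "K\<lparr>carrier := A\<rparr>" fst] subcring_iff[OF A(1)] subcring_axioms by simp
    moreover have "\<one>\<^bsub>K\<^esub> \<in> E"
    proof -
      obtain e where e: "e \<in> E" "e \<noteq> \<zero>\<^bsub>K\<^esub>"
        using assms(3) E0 by auto
      \<comment> \<open>Multiplying \<open>e\<close> by a denominator \<open>b\<close> brings it
        into \<open>A\<close>, and it stays in \<open>E\<close> because \<open>b\<close> is a
        scalar. This yields a nonzero element of both.\<close>
      obtain b where b: "b \<in> A" "b \<noteq> \<zero>\<^bsub>K\<^esub>" "b \<otimes>\<^bsub>K\<^esub> e \<in> A"
        using ex_common_denominator[of "{e}"] e EK by auto
      define a where "a = b \<otimes>\<^bsub>K\<^esub> e"
      have a: "a \<in> A" "a \<in> E" "a \<noteq> \<zero>\<^bsub>K\<^esub>"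
        using b e Esmult EK A(1) integral[of b e] by (auto simp: a_def)
      then have aK: "a \<in> carrier K" using EK by auto
      have "(a, \<zero>\<^bsub>K\<^esub>) \<in> carrier ?R" "(\<zero>\<^bsub>K\<^esub>, a) \<in> carrier ?R"
        using a aK A Eneg by (auto simp: mem minus_eq)
      then obtain d u v p q where carr: "d \<in> carrier ?R" "u \<in> carrier ?R" "v \<in> carrier ?R"
        "p \<in> carrier ?R" "q \<in> carrier ?R"
        and gen: "(a, \<zero>\<^bsub>K\<^esub>) = d \<otimes>\<^bsub>?R\<^esub> u" "(\<zero>\<^bsub>K\<^esub>, a) = d \<otimes>\<^bsub>?R\<^esub> v"
          "d = (a, \<zero>\<^bsub>K\<^esub>) \<otimes>\<^bsub>?R\<^esub> p \<oplus>\<^bsub>?R\<^esub> (\<zero>\<^bsub>K\<^esub>, a) \<otimes>\<^bsub>?R\<^esub> q"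
        by (rule R.two_generated_ideal_principal)
      obtain d1 d2 u1 u2 v1 v2 p1 p2 q1 q2
        where pairs: "d = (d1, d2)" "u = (u1, u2)" "v = (v1, v2)" "p = (p1, p2)" "q = (q1, q2)"
        by (metis surj_pair)
      have *: "d1 \<in> A" "d2 \<in> carrier K" "u1 \<in> A" "u2 \<in> carrier K" "u2 \<ominus>\<^bsub>K\<^esub> u1 \<in> E"
        "v2 \<in> carrier K" "p1 \<in> A" "q1 \<in> A"
        using carr unfolding pairs mem by simp_all
      have a1: "a = d1 \<otimes>\<^bsub>K\<^esub> u1" and d2u2: "d2 \<otimes>\<^bsub>K\<^esub> u2 = \<zero>\<^bsub>K\<^esub>"
        using gen(1) unfolding pairs amalgamated_duplication_simps by simp_all
      have a2: "a = d2 \<otimes>\<^bsub>K\<^esub> v2"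
        using gen(2) unfolding pairs amalgamated_duplication_simps by simp
      have d1: "d1 = a \<otimes>\<^bsub>K\<^esub> p1 \<oplus>\<^bsub>K\<^esub> \<zero>\<^bsub>K\<^esub> \<otimes>\<^bsub>K\<^esub> q1"
        using gen(3) unfolding pairs amalgamated_duplication_simps by blast
      have **: "u1 \<in> carrier K" "p1 \<in> carrier K" "q1 \<in> carrier K"
        using * A(1) by auto
      \<comment> \<open>The second component of \<open>(0, a) = d v\<close> reads
        \<open>a = d2 v2\<close> with \<open>a\<close> nonzero. The one of
        \<open>(a, 0) = d u\<close> then forces \<open>u2 = 0\<close>, so
        \<open>u2 - u1 \<in> E\<close> says that \<open>-u1 \<in> E\<close>.\<close>
      have "d2 \<noteq> \<zero>\<^bsub>K\<^esub>"
        using a(3) a2 *(6) by (metis l_null)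
      then have "u2 = \<zero>\<^bsub>K\<^esub>"
        using d2u2 * integral by blast
      then have "u1 \<in> E"
        using Eneg[OF *(5)] ** by (simp add: minus_eq)
      \<comment> \<open>Substituting \<open>d1 = a p1\<close> into \<open>a = d1 u1\<close> and
        cancelling \<open>a\<close> makes \<open>p1\<close> an inverse of \<open>u1\<close>. Then
        \<open>p1 u1 = 1\<close> is an \<open>A\<close>-multiple of an element of
        \<open>E\<close>.\<close>
      moreover have "a \<otimes>\<^bsub>K\<^esub> (p1 \<otimes>\<^bsub>K\<^esub> u1) = (a \<otimes>\<^bsub>K\<^esub> p1 \<oplus>\<^bsub>K\<^esub> \<zero>\<^bsub>K\<^esub> \<otimes>\<^bsub>K\<^esub> q1) \<otimes>\<^bsub>K\<^esub> u1"
        using aK ** by (simp add: m_assoc)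
      then have "a \<otimes>\<^bsub>K\<^esub> (p1 \<otimes>\<^bsub>K\<^esub> u1) = a \<otimes>\<^bsub>K\<^esub> \<one>\<^bsub>K\<^esub>"
        unfolding d1[symmetric] a1[symmetric] using aK by simp
      then have "p1 \<otimes>\<^bsub>K\<^esub> u1 = \<one>\<^bsub>K\<^esub>"
        using m_lcancel[OF a(3) aK, of "p1 \<otimes>\<^bsub>K\<^esub> u1" "\<one>\<^bsub>K\<^esub>"] ** by simp
      ultimately show ?thesis
        using Esmult *(7) by metis
    qed
    ultimately show "elementary_divisor_ring (K\<lparr>carrier := A\<rparr>) \<and> A \<subseteq> E"
      using Esmult A(1) by (metis r_one subset_iff)
  next
    assume "elementary_divisor_ring (K\<lparr>carrier := A\<rparr>) \<and> A \<subseteq> E"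
    then have EDR: "elementary_divisor_ring (K\<lparr>carrier := A\<rparr>)" and AE: "A \<subseteq> E"
      by auto
    \<comment> \<open>The unit of \<open>K\<close> reaches \<open>E\<close> through
      \<open>A\<close>.\<close>
    have "subring E K"
      using EK A(3) AE Eneg Emult Eadd by (intro subringI) auto
    have "A <+>\<^bsub>K\<^esub> E = E"
    proof
      show "A <+>\<^bsub>K\<^esub> E \<subseteq> E"
        using AE Eadd by (auto simp: set_add_def')
      show "E \<subseteq> A <+>\<^bsub>K\<^esub> E"
      proof
        fix x assume "x \<in> E"
        then show "x \<in> A <+>\<^bsub>K\<^esub> E"
          using A(2) l_zero[of x] EK unfolding set_add_def' by force
      qed
    qed
    moreover have "carrier ?R = A \<times> E"
    proof -
      \<comment> \<open>As \<open>x\<close> itself lies in \<open>E\<close>, subtracting it does not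
        affect membership in \<open>E\<close>: the second component ranges over \<open>E\<close>
        independently of the first.\<close>
      have "y \<ominus>\<^bsub>K\<^esub> x \<in> E \<longleftrightarrow> y \<in> E" if "x \<in> A" "y \<in> carrier K" for x y
      proof
        assume "y \<ominus>\<^bsub>K\<^esub> x \<in> E"
        moreover have "y = x \<oplus>\<^bsub>K\<^esub> (y \<ominus>\<^bsub>K\<^esub> x)"
        proof -
          have "x \<in> carrier K" using that A(1) by auto
          then show ?thesis using that(2) by algebra
        qed
        ultimately show "y \<in> E"
          using Eadd that AE by (metis subsetD)
      qed (use that AE Ediff in auto)
      then show ?thesis
        using EK by (auto simp: mem)
    qed
    \<comment> \<open>The duplication is a direct product with its carrier replaced. Here the second
      factor \<open>A + E\<close> is \<open>E\<close> and the new carrier is the full one, so the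
      two records coincide.\<close>
    ultimately have "?R = RDirProd (K\<lparr>carrier := A\<rparr>) (K\<lparr>carrier := E\<rparr>)"
      by (auto simp: amalgamated_duplication_def RDirProd_carrier)
    then show "elementary_divisor_ring ?R"
      using elementary_divisor_ring_RDirProd EDR
        elementary_divisor_overring[OF EDR \<open>subring E K\<close> AE] by simp
  qed
qed

end
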